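(* Let $1<\alpha<2$, $K_\alpha>0$, $L,T>0$. Let $u(x,t)$ be the solution of $$\frac{\partial u(x,t)}{\partial t}=-u(x,t)+K_\alpha\frac{\partial^\alpha u(x,t)}{\partial|x|^\alpha}+f(x,t),\quad 0<x<L,\ 0<t\le T,$$ $$u(x,0)=u^0(x),\ 0\le x\le L,\qquad u(0,t)=u(L,t)=0,\ 0<t\le T,$$ and let $u_j^k$ be the solution of the finite difference scheme $$\mathcal{L}\delta_t u_j^{k+\frac12}=-\mathcal{L}u_j^{k+\frac12}+K_\alpha\delta_x^\alpha u_j^{k+\frac12}+\mathcal{L}f_j^{k+\frac12},\quad 0\le k\le N-1,\ 1\le j\le M-1,$$ $$u_j^0=u^0(x_j),\ 0\le j\le M,\qquad u_0^k=u_M^k=0,\ 1\le k\le N.$$ Denote $e_j^k=u_j^k-u(x_j,t_k)$ for $0\le k\le N$, $0\le j\le M$. Then $$\|\boldsymbol{e}^k\|\le\frac{\sqrt{6LT}}{6}\,C_1\exp\left(\frac13T\right)(\tau^2+h^3),\qquad 0\le k\le N,$$ where $C_1$ is a constant independent of $\tau$ and $h$.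
   Context: Grid: $\tau=T/N$, $h=L/M$ ($M,N$ positive integers), $t_k=k\tau$, $t_{k+\frac12}=(k+\frac12)\tau$, $x_j=jh$. Notation: $\delta_tu_j^{k+\frac12}=\frac{u_j^{k+1}-u_j^k}{\tau}$, $u_j^{k+\frac12}=\frac{u_j^{k+1}+u_j^k}{2}$, and $f_j^{k+\frac12}=f(x_j,t_{k+\frac12})$. The Riesz derivative in $x$ on $(a,b)=(0,L)$ is $$\frac{\partial^\alpha u}{\partial|x|^\alpha}=-\frac{1}{2\cos(\frac{\pi\alpha}{2})}\left({}_{RL}D_{a,x}^\alpha+{}_{RL}D_{x,b}^\alpha\right)u,$$ with ${}_{RL}D_{a,x}^{\alpha}u(x)=\frac{1}{\Gamma(2-\alpha)}\frac{d^2}{dx^2}\int_{a}^{x}\frac{u(s)ds}{(x-s)^{\alpha-1}}$ and ${}_{RL}D_{x,b}^{\alpha}u(x)=\frac{1}{\Gamma(2-\alpha)}\frac{d^2}{dx^2}\int_{x}^{b}\frac{u(s)ds}{(s-x)^{\alpha-1}}$. $\mathcal{L}w_j=w_j+\sigma_2^{(\alpha)}(w_{j+1}-2w_j+w_{j-1})$ with $\sigma_2^{(\alpha)}=-\frac{2\alpha^2-6\alpha+3}{6\alpha}$. $$\delta_x^\alpha w_j=-\frac{1}{2\cos(\frac{\pi\alpha}{2})h^\alpha}\left(\sum_{\ell=0}^{j+1}\kappa_{2,\ell}^{(\alpha)}w_{j-\ell+1}+\sum_{\ell=0}^{M-j+1}\kappa_{2,\ell}^{(\alpha)}w_{j+\ell-1}\right),$$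 with $\left(\frac{3\alpha-2}{2\alpha}-\frac{2(\alpha-1)}{\alpha}z+\frac{\alpha-2}{2\alpha}z^2\right)^{\alpha}=\sum_{\ell=0}^{\infty}\kappa_{2,\ell}^{(\alpha)}z^\ell$, $|z|<1$. Norm: $\|\boldsymbol v\|^2=h\sum_{j=1}^{M-1}v_j^2$ for grid functions vanishing at $j=0,M$. Standing assumption: $f$, $u^0$ and the solution $u$ are smooth enough that the local truncation error obeys the expected bound: writing $U_j^k=u(x_j,t_k)$ and $$R_j^k=\mathcal{L}\delta_tU_j^{k+\frac12}+\mathcal{L}U_j^{k+\frac12}-K_\alpha\delta_x^\alpha U_j^{k+\frac12}-\mathcal{L}f(x_j,t_{k+\frac12}),$$ there is a positive constant $C$ independent of $\tau,h$ with $|R_j^k|\le C(\tau^2+h^3)$ for $0\le k\le N-1$, $1\le j\le M-1$. *)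

theory Defs
  imports "HOL-Complex_Analysis.Complex_Analysis"
begin

definition rl_left_integral :: "real \<Rightarrow> real \<Rightarrow> (real \<Rightarrow> real) \<Rightarrow> real \<Rightarrow> real" where
  "rl_left_integral a \<alpha> g y = (LBINT s:{a..y}. g s / (y - s) powr (\<alpha> - 1))"

definition rl_right_integral :: "real \<Rightarrow> real \<Rightarrow> (real \<Rightarrow> real) \<Rightarrow> real \<Rightarrow> real" where
  "rl_right_integral b \<alpha> g y = (LBINT s:{y..b}. g s / (s - y) powr (\<alpha> - 1))"

definition rl_left :: "real \<Rightarrow> real \<Rightarrow> (real \<Rightarrow> real) \<Rightarrow> real \<Rightarrow> real" where
  "rl_left a \<alpha> g x = 1 / Gamma (2 - \<alpha>) * deriv (deriv (rl_left_integral a \<alpha> g)) x"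

definition rl_right :: "real \<Rightarrow> real \<Rightarrow> (real \<Rightarrow> real) \<Rightarrow> real \<Rightarrow> real" where
  "rl_right b \<alpha> g x = 1 / Gamma (2 - \<alpha>) * deriv (deriv (rl_right_integral b \<alpha> g)) x"

definition riesz_deriv :: "real \<Rightarrow> real \<Rightarrow> real \<Rightarrow> (real \<Rightarrow> real) \<Rightarrow> real \<Rightarrow> real" where
  "riesz_deriv a b \<alpha> g x =
     - 1 / (2 * cos (pi * \<alpha> / 2)) * (rl_left a \<alpha> g x + rl_right b \<alpha> g x)"

text \<open>The operators above are total, with arbitrary values where an integral or a derivative
  does not exist.  The following predicate says that every integral and derivative occurring in
  the Riesz derivative of \<open>g\<close> at \<open>x\<close> exists.\<close>

definition riesz_deriv_exists :: "real \<Rightarrow> real \<Rightarrow> real \<Rightarrow> (real \<Rightarrow> real) \<Rightarrow> real \<Rightarrow> bool" where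
  "riesz_deriv_exists a b \<alpha> g x \<longleftrightarrow>
     (\<forall>\<^sub>F y in nhds x.
        set_integrable lborel {a..y} (\<lambda>s. g s / (y - s) powr (\<alpha> - 1)) \<and>
        set_integrable lborel {y..b} (\<lambda>s. g s / (s - y) powr (\<alpha> - 1)) \<and>
        rl_left_integral a \<alpha> g differentiable at y \<and>
        rl_right_integral b \<alpha> g differentiable at y) \<and>
     deriv (rl_left_integral a \<alpha> g) differentiable at x \<and>
     deriv (rl_right_integral b \<alpha> g) differentiable at x"

text \<open>Here \<open>u x t\<close> stands for $u(x,t)$.  The time derivative is taken within \<open>{0..T}\<close>, which is
  the usual derivative for \<open>t < T\<close> and the left-hand derivative at \<open>t = T\<close>.\<close>

definition pde_solution ::
  "real \<Rightarrow> real \<Rightarrow> real \<Rightarrow> real \<Rightarrow> (real \<Rightarrow> real \<Rightarrow> real) \<Rightarrow> (real \<Rightarrow> real) \<Rightarrow> (real \<Rightarrow> real \<Rightarrow> real) \<Rightarrow> bool"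
where
  "pde_solution \<alpha> K L T f u0 u \<longleftrightarrow>
     (\<forall>x t. 0 < x \<and> x < L \<and> 0 < t \<and> t \<le> T \<longrightarrow>
        riesz_deriv_exists 0 L \<alpha> (\<lambda>y. u y t) x \<and>
        ((\<lambda>s. u x s) has_real_derivative
           - u x t + K * riesz_deriv 0 L \<alpha> (\<lambda>y. u y t) x + f x t) (at t within {0..T})) \<and>
     (\<forall>x. 0 \<le> x \<and> x \<le> L \<longrightarrow> u x 0 = u0 x) \<and>
     (\<forall>t. 0 < t \<and> t \<le> T \<longrightarrow> u 0 t = 0 \<and> u L t = 0)"

definition sigma2 :: "real \<Rightarrow> real" where
  "sigma2 \<alpha> = - (2 * \<alpha>\<^sup>2 - 6 * \<alpha> + 3) / (6 * \<alpha>)"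

definition opL :: "real \<Rightarrow> (nat \<Rightarrow> real) \<Rightarrow> nat \<Rightarrow> real" where
  "opL \<alpha> w j = w j + sigma2 \<alpha> * (w (j + 1) - 2 * w j + w (j - 1))"

definition genfun2 :: "real \<Rightarrow> complex \<Rightarrow> complex" where
  "genfun2 \<alpha> z =
     (of_real ((3 * \<alpha> - 2) / (2 * \<alpha>)) - of_real (2 * (\<alpha> - 1) / \<alpha>) * z
        + of_real ((\<alpha> - 2) / (2 * \<alpha>)) * z\<^sup>2) powr of_real \<alpha>"

text \<open>The complex power is the principal one; lemma \<open>kappa2_sums\<close> shows that the
  expansion exists on the whole unit disc, so the description is a proper one.\<close>

definition kappa2 :: "real \<Rightarrow> nat \<Rightarrow> real" where
  "kappa2 \<alpha> = (THE c. \<forall>z::complex. norm z < 1 \<longrightarrow> (\<lambda>l. of_real (c l) * z ^ l) sums genfun2 \<alpha> z)"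

lemma genfun2_base_not_nonpos:
  fixes z :: complex
  assumes "1 < \<alpha>" "\<alpha> < 2" "norm z < 1"
  shows "of_real ((3 * \<alpha> - 2) / (2 * \<alpha>)) - of_real (2 * (\<alpha> - 1) / \<alpha>) * z
           + of_real ((\<alpha> - 2) / (2 * \<alpha>)) * z\<^sup>2 \<notin> \<real>\<^sub>\<le>\<^sub>0" (is "?W \<notin> _")
proof
  assume "?W \<in> \<real>\<^sub>\<le>\<^sub>0"
  then obtain x where x: "x \<le> 0" "?W = of_real x"
    by (auto elim: nonpos_Reals_cases)
  define p q where "p = (3 * \<alpha> - 2) / (2 * \<alpha>)" and "q = (2 - \<alpha>) / (2 * \<alpha>)"
  have pq: "q < p" "0 < q" "2 * (\<alpha> - 1) / \<alpha> = p - q" "(\<alpha> - 2) / (2 * \<alpha>) = - q"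
    using assms by (auto simp: p_def q_def field_simps)
  define a b where "a = 1 - z" and "b = of_real p + of_real q * z"
  have ab: "a * b = of_real x"
    unfolding x(2)[symmetric] pq(3,4) a_def b_def p_def[symmetric]
    by (simp add: algebra_simps power2_eq_square)
  have rz: "\<bar>Re z\<bar> < 1"
    using abs_Re_le_cmod[of z] assms by linarith
  have ra: "Re a > 0"
    using rz by (simp add: a_def)
  have "q * (- Re z) \<le> q * 1"
    using rz pq by (intro mult_left_mono) auto
  then have rb: "Re b > 0"
    using pq by (simp add: b_def)
  have "Re a * Re b - Im a * Im b = x" "Re a * Im b + Im a * Re b = 0"
    using ab by (simp_all add: complex_eq_iff)
  then have x_eq: "x = Re a * Re b - Im a * Im b" and im: "Re a * Im b = - (Im a * Re b)"
    by simp_all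
  have "Re a * x = (Re a)\<^sup>2 * Re b - Im a * (Re a * Im b)"
    unfolding x_eq by (simp add: algebra_simps power2_eq_square)
  then have "Re a * x = Re b * ((Re a)\<^sup>2 + (Im a)\<^sup>2)"
    unfolding im by (simp add: algebra_simps power2_eq_square)
  moreover have "Re b * ((Re a)\<^sup>2 + (Im a)\<^sup>2) > 0"
    using ra rb by (simp add: add_pos_nonneg)
  moreover have "Re a * x \<le> 0"
    using ra x by (simp add: mult_nonneg_nonpos)
  ultimately show False by linarith
qed

lemma power_series_coeffs_unique:
  fixes c d :: "nat \<Rightarrow> complex"
  assumes "\<And>z. norm z < 1 \<Longrightarrow> (\<lambda>l. c l * z ^ l) sums g z"
    and "\<And>z. norm z < 1 \<Longrightarrow> (\<lambda>l. d l * z ^ l) sums g z"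
  shows "c = d"
proof -
  have cr: "fps_conv_radius (Abs_fps a) > 0" "eval_fps (Abs_fps a) z = g z"
    if "\<And>z. norm z < 1 \<Longrightarrow> (\<lambda>l. a l * z ^ l) sums g z" "norm z < 1" for a and z :: complex
  proof -
    have "summable (\<lambda>l. a l * (1 / 2) ^ l)"
      using that(1)[of "1 / 2"] by (auto simp: sums_iff)
    then have "norm (1 / 2 :: complex) \<le> conv_radius a"
      by (rule conv_radius_geI)
    then have "0 < conv_radius a"
      by (rule less_le_trans[rotated]) simp
    then show "fps_conv_radius (Abs_fps a) > 0"
      by (simp add: fps_conv_radius_def)
    show "eval_fps (Abs_fps a) z = g z"
      using that by (simp add: eval_fps_def sums_iff)
  qed
  have ev: "\<forall>\<^sub>F z in nhds 0. norm (z::complex) < 1"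
    using eventually_nhds_in_open[of "ball 0 1" "0::complex"] by (simp add: dist_norm)
  have "Abs_fps c = Abs_fps d"
  proof (rule eval_fps_eqD)
    show "fps_conv_radius (Abs_fps c) > 0" "fps_conv_radius (Abs_fps d) > 0"
      using cr(1)[of c 0] cr(1)[of d 0] assms by auto
    show "\<forall>\<^sub>F z in nhds 0. eval_fps (Abs_fps c) z = eval_fps (Abs_fps d) z"
      using ev by eventually_elim (use cr(2)[of c] cr(2)[of d] assms in auto)
  qed
  then show ?thesis
    by (auto simp: fps_eq_iff)
qed

lemma kappa2_sums:
  fixes z :: complex
  assumes "1 < \<alpha>" "\<alpha> < 2" "norm z < 1"
  shows "(\<lambda>l. of_real (kappa2 \<alpha> l) * z ^ l) sums genfun2 \<alpha> z"
proof -
  let ?P = "\<lambda>c. \<forall>z::complex. norm z < 1 \<longrightarrow> (\<lambda>l. of_real (c l) * z ^ l) sums genfun2 \<alpha> z"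
  define d where "d l = (deriv ^^ l) (genfun2 \<alpha>) 0 / fact l" for l
  have hol: "genfun2 \<alpha> holomorphic_on ball 0 1"
    unfolding genfun2_def using genfun2_base_not_nonpos[OF assms(1,2)]
    by (intro holomorphic_intros) auto
  have d: "(\<lambda>l. d l * w ^ l) sums genfun2 \<alpha> w" if "norm w < 1" for w
    using holomorphic_power_series[OF hol, of w] that by (simp add: d_def)
  have conj: "cnj (genfun2 \<alpha> (cnj w)) = genfun2 \<alpha> w" if "norm w < 1" for w
    unfolding genfun2_def
    using genfun2_base_not_nonpos[OF assms(1,2), of "cnj w"] that
    by (subst cnj_powr; force simp: complex_nonpos_Reals_iff simp del: of_real_divide of_real_diff of_real_mult)
  have "(\<lambda>l. cnj (d l) * w ^ l) sums genfun2 \<alpha> w" if "norm w < 1" for w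
    using iffD2[OF sums_cnj, OF d[of "cnj w"]] that conj[OF that] by simp
  then have "(\<lambda>l. cnj (d l)) = d"
    by (rule power_series_coeffs_unique[of _ "genfun2 \<alpha>"]) (use d in auto)
  then have "cnj (d l) = d l" for l
    by (rule fun_cong)
  then have re: "of_real (Re (d l)) = d l" for l
    by (simp add: Reals_cnj_iff)
  have ex: "?P (\<lambda>l. Re (d l))"
    using d by (simp add: re)
  have uniq: "c = c'" if "?P c" "?P c'" for c c'
  proof -
    have "(\<lambda>l. complex_of_real (c l)) = (\<lambda>l. of_real (c' l))"
      using that by (intro power_series_coeffs_unique[of _ "genfun2 \<alpha>"]) blast+
    then show ?thesis by (simp add: fun_eq_iff)
  qed
  have "\<exists>!c. ?P c"
    by (rule ex1I[of ?P, OF ex]) (rule uniq[OF _ ex])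
  then have "?P (kappa2 \<alpha>)"
    unfolding kappa2_def by (rule theI')
  then show ?thesis using assms by blast
qed

text \<open>For \<open>1 \<le> j < M\<close> the truncated subtractions \<open>j - 1\<close>, \<open>j + 1 - l\<close>, \<open>j + l - 1\<close>, \<open>M - j\<close>
  on natural numbers agree with those on integers.\<close>

definition delta_x :: "real \<Rightarrow> nat \<Rightarrow> real \<Rightarrow> (nat \<Rightarrow> real) \<Rightarrow> nat \<Rightarrow> real" where
  "delta_x \<alpha> M h w j =
     - 1 / (2 * cos (pi * \<alpha> / 2) * h powr \<alpha>) *
       ((\<Sum>l = 0..j + 1. kappa2 \<alpha> l * w (j + 1 - l)) +
        (\<Sum>l = 0..M - j + 1. kappa2 \<alpha> l * w (j + l - 1)))"

definition delta_t :: "real \<Rightarrow> (nat \<Rightarrow> nat \<Rightarrow> real) \<Rightarrow> nat \<Rightarrow> nat \<Rightarrow> real" where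
  "delta_t \<tau> v k j = (v (k + 1) j - v k j) / \<tau>"

definition time_avg :: "(nat \<Rightarrow> nat \<Rightarrow> real) \<Rightarrow> nat \<Rightarrow> nat \<Rightarrow> real" where
  "time_avg v k j = (v (k + 1) j + v k j) / 2"

definition half_step :: "real \<Rightarrow> real \<Rightarrow> (real \<Rightarrow> real \<Rightarrow> real) \<Rightarrow> nat \<Rightarrow> nat \<Rightarrow> real" where
  "half_step h \<tau> f k j = f (real j * h) ((real k + 1 / 2) * \<tau>)"

definition on_grid :: "real \<Rightarrow> real \<Rightarrow> (real \<Rightarrow> real \<Rightarrow> real) \<Rightarrow> nat \<Rightarrow> nat \<Rightarrow> real" where
  "on_grid h \<tau> u k j = u (real j * h) (real k * \<tau>)"

text \<open>In the remaining definitions \<open>v k j\<close> stands for $v_j^k$; only \<open>k \<le> N\<close>, \<open>j \<le> M\<close> matter.\<close>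

definition truncation_error ::
  "real \<Rightarrow> real \<Rightarrow> real \<Rightarrow> real \<Rightarrow> (real \<Rightarrow> real \<Rightarrow> real) \<Rightarrow> (real \<Rightarrow> real \<Rightarrow> real) \<Rightarrow> nat \<Rightarrow> nat \<Rightarrow> nat \<Rightarrow> nat \<Rightarrow> real"
where
  "truncation_error \<alpha> K L T f u M N k j =
     (let h = L / real M; \<tau> = T / real N; U = on_grid h \<tau> u
      in opL \<alpha> (delta_t \<tau> U k) j + opL \<alpha> (time_avg U k) j
         - K * delta_x \<alpha> M h (time_avg U k) j - opL \<alpha> (half_step h \<tau> f k) j)"

definition scheme_solution ::
  "real \<Rightarrow> real \<Rightarrow> real \<Rightarrow> real \<Rightarrow> (real \<Rightarrow> real \<Rightarrow> real) \<Rightarrow> (real \<Rightarrow> real) \<Rightarrow> nat \<Rightarrow> nat \<Rightarrow> (nat \<Rightarrow> nat \<Rightarrow> real) \<Rightarrow> bool"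
where
  "scheme_solution \<alpha> K L T f u0 M N v \<longleftrightarrow>
     (let h = L / real M; \<tau> = T / real N in
        (\<forall>k<N. \<forall>j\<in>{1..<M}.
           opL \<alpha> (delta_t \<tau> v k) j =
             - opL \<alpha> (time_avg v k) j + K * delta_x \<alpha> M h (time_avg v k) j
             + opL \<alpha> (half_step h \<tau> f k) j) \<and>
        (\<forall>j\<le>M. v 0 j = u0 (real j * h)) \<and>
        (\<forall>k\<in>{1..N}. v k 0 = 0 \<and> v k M = 0))"

definition grid_norm :: "nat \<Rightarrow> real \<Rightarrow> (nat \<Rightarrow> real) \<Rightarrow> real" where
  "grid_norm M h w = sqrt (h * (\<Sum>j\<in>{1..<M}. (w j)\<^sup>2))"

end

theory Submission
  imports Defs
begin

text \<open>
  The error \<open>e\<close> of the scheme satisfies the linear scheme whose right-hand side is minus the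
  truncation error, with zero initial and boundary values.  Its inner product with the time average
  \<open>a\<close> of \<open>e\<close> over one step yields an energy estimate that rests on two facts.

  First, \<open>opL\<close> is symmetric and at least \<open>c = 1 - 4 * sigma2 \<alpha> > 0\<close> on grid functions that vanish at
  the boundary (\<open>opL_form_commute\<close>, \<open>opL_form_coercive\<close>, \<open>sigma2_bounds\<close>).  The difference quotient
  therefore contributes the increment of the energy \<open>(e, opL e)\<close>, a sum over the interior grid
  points, and the reaction term is at least \<open>c * \<parallel>a\<parallel>\<^sup>2\<close>.

  Second, \<open>delta_x\<close> is negative semidefinite (\<open>delta_x_form_nonpos\<close>).  It is a nonnegative multiple
  of a Toeplitz matrix plus its transpose, and the symbol of that matrix is
  \<open>cis (- t) * genfun2 \<alpha> (cis t)\<close>; by Fourier expansion it is enough that the symbol has nonpositive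
  real part (\<open>toeplitz_form_nonpos\<close>).  With \<open>q = (2 - \<alpha>) / (2 * \<alpha>)\<close> the generating function is
  \<open>(1 - z) powr \<alpha> * (1 - q + q * z) powr \<alpha>\<close>, so for \<open>0 < t \<le> pi\<close> the argument of the symbol is
  \<open>\<alpha> * (t - pi) / 2 + \<alpha> * \<phi> - t\<close> with \<open>\<phi>\<close> the argument of \<open>1 - q + q * cis t\<close>.  From
  \<open>0 \<le> \<phi> \<le> q * t\<close> this lies between \<open>- pi\<close> and \<open>- \<alpha> * pi / 2\<close>, where the cosine is nonpositive
  (\<open>genfun2_symbol_nonpos\<close>).

  The reaction term absorbs the residual by Young's inequality, so the energy grows by at most
  \<open>\<tau> * M * (C * (\<tau>\<^sup>2 + h ^ 3))\<^sup>2 / (2 * c)\<close> per step.  Summation over the steps bounds the error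
  without a Gronwall argument; the exponential in the claim enters only through being at least \<open>1\<close>.
\<close>

section \<open>The sign of the symbol\<close>

text \<open>For \<open>0 < q\<close> and \<open>0 < t\<close> this says that \<open>sin x / x\<close> decreases on \<open>[0, pi]\<close>,
  compared at \<open>x = q * t\<close> and \<open>x = p * t\<close>.\<close>

lemma mult_sin_le_mult_sin:
  fixes p q t :: real
  assumes "0 \<le> q" "q \<le> p" "0 \<le> t" "p * t \<le> pi"
  shows "q * sin (p * t) \<le> p * sin (q * t)"
proof -
  let ?h = "\<lambda>t. p * sin (q * t) - q * sin (p * t)"
  have "?h 0 \<le> ?h t"
  proof (rule DERIV_nonneg_imp_nondecreasing[OF \<open>0 \<le> t\<close>])
    fix s assume s: "0 \<le> s" "s \<le> t"
    have "p * s \<le> p * t" using s assms by (intro mult_left_mono) auto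
    then have "cos (p * s) \<le> cos (q * s)"
      using s assms by (intro cos_monotone_0_pi_le mult_right_mono) auto
    then have "p * q * (cos (q * s) - cos (p * s)) \<ge> 0"
      using assms by simp
    moreover have "(?h has_real_derivative p * q * (cos (q * s) - cos (p * s))) (at s)"
      by (auto intro!: derivative_eq_intros simp: algebra_simps)
    ultimately show "\<exists>y. (?h has_real_derivative y) (at s) \<and> 0 \<le> y"
      by blast
  qed
  then show ?thesis by simp
qed

text \<open>The argument of \<open>(1 - q) + q * cis t\<close> lies between \<open>0\<close> and its tangent line \<open>q * t\<close> at
  \<open>t = 0\<close>.  For \<open>q = (2 - \<alpha>) / (2 * \<alpha>)\<close> this slope is the one that cancels the remaining terms linear
  in \<open>t\<close> in the argument of the symbol.\<close>

lemma Im_Ln_convex_comb_cis: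
  fixes q t :: real
  assumes q: "0 < q" "q < 1 / 2" and t: "0 \<le> t" "t \<le> pi"
  shows "0 \<le> Im (Ln (of_real (1 - q) + of_real q * cis t))"
    and "Im (Ln (of_real (1 - q) + of_real q * cis t)) \<le> q * t"
proof -
  define z where "z = of_real (1 - q) + of_real q * cis t"
  define \<phi> where "\<phi> = Im (Ln z)"
  have "q * - cos t \<le> q * 1"
    using q by (intro mult_left_mono) (auto simp: minus_le_iff)
  then have re: "Re z > 0"
    using q by (simp add: z_def)
  then have nz: "z \<noteq> 0" by auto
  have im: "Im z \<ge> 0"
    using q t by (simp add: z_def sin_ge_zero)
  show nonneg: "0 \<le> Im (Ln (of_real (1 - q) + of_real q * cis t))"
    using Im_Ln_pos_le[OF nz] im by (simp add: z_def)
  have lt: "\<phi> < pi / 2"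
    using Re_Ln_pos_lt_imp[OF re] by (simp add: \<phi>_def)
  have qt: "q * t \<le> pi / 2" "0 \<le> q * t"
    using mult_mono[of q "1/2" t pi] q t by auto
  \<comment> \<open>Rotating \<open>z\<close> by \<open>- q * t\<close> must not leave a positive imaginary part.\<close>
  have "\<phi> \<le> q * t"
  proof (rule ccontr)
    assume *: "\<not> \<phi> \<le> q * t"
    have "z = exp (Ln z)" using nz by simp
    also have "\<dots> = of_real (norm z) * cis \<phi>"
      using nz unfolding exp_eq_polar[of "Ln z"] \<phi>_def by simp
    finally have "z * cis (- (q * t)) = of_real (norm z) * cis \<phi> * cis (- (q * t))"
      by (rule arg_cong[where f = "\<lambda>y. y * cis (- (q * t))"])
    then have "z * cis (- (q * t)) = of_real (norm z) * cis (\<phi> - q * t)"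
      unfolding mult.assoc cis_mult by simp
    moreover have "z * cis (- (q * t))
        = of_real (1 - q) * cis (- (q * t)) + of_real q * cis ((1 - q) * t)"
      by (simp add: z_def algebra_simps cis_mult)
    ultimately have "of_real (norm z) * cis (\<phi> - q * t)
        = of_real (1 - q) * cis (- (q * t)) + of_real q * cis ((1 - q) * t)"
      by simp
    then have "norm z * sin (\<phi> - q * t) = q * sin ((1 - q) * t) - (1 - q) * sin (q * t)"
      by (auto simp: complex_eq_iff)
    also have "\<dots> \<le> 0"
      using mult_sin_le_mult_sin[of q "1 - q" t] q t mult_mono[of "1 - q" 1 t pi] by simp
    finally have "sin (\<phi> - q * t) \<le> 0"
      using nz by (simp add: mult_le_0_iff)
    moreover have "sin (\<phi> - q * t) > 0"
      using * lt qt by (intro sin_gt_zero) auto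
    ultimately show False by simp
  qed
  then show "Im (Ln (of_real (1 - q) + of_real q * cis t)) \<le> q * t"
    by (simp add: \<phi>_def z_def)
qed

lemma Re_add_scaled_pos:
  fixes z :: complex and q :: real
  assumes "0 < q" "q < 1 / 2" "norm z \<le> 1"
  shows "0 < Re (of_real (1 - q) + of_real q * z)"
proof -
  have "q * - Re z \<le> q * 1"
    using assms abs_Re_le_cmod[of z] by (intro mult_left_mono) auto
  then show ?thesis using assms by simp
qed

text \<open>The quadratic in the generating function has the roots \<open>1\<close> and \<open>- (1 - q) / q\<close>.  On the closed
  unit disc both factors have nonnegative real part, so their principal logarithms add up without
  crossing the branch cut, and the power splits.\<close>

lemma genfun2_eq_prod:
  fixes z :: complex
  assumes \<alpha>: "1 < \<alpha>" "\<alpha> < 2" and z: "norm z \<le> 1"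
  defines "q \<equiv> (2 - \<alpha>) / (2 * \<alpha>)"
  shows "genfun2 \<alpha> z
    = (1 - z) powr of_real \<alpha> * (of_real (1 - q) + of_real q * z) powr of_real \<alpha>"
proof -
  define b where "b = of_real (1 - q) + of_real q * z"
  have q: "0 < q" "q < 1 / 2"
    using \<alpha> by (auto simp: q_def field_simps)
  have coeffs: "(3 * \<alpha> - 2) / (2 * \<alpha>) = 1 - q" "2 * (\<alpha> - 1) / \<alpha> = 1 - 2 * q"
      "(\<alpha> - 2) / (2 * \<alpha>) = - q"
    using \<alpha> by (auto simp: q_def field_simps)
  have base: "genfun2 \<alpha> z = ((1 - z) * b) powr of_real \<alpha>"
    unfolding genfun2_def coeffs b_def by (simp add: algebra_simps power2_eq_square)
  show ?thesis
  proof (cases "z = 1")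
    case True
    then show ?thesis unfolding base by simp
  next
    case False
    have b: "0 < Re b" unfolding b_def by (rule Re_add_scaled_pos[OF q z])
    then have bnz: "b \<noteq> 0" by auto
    have "Re (1 - z) \<ge> 0"
      using abs_Re_le_cmod[of z] z by simp
    then have "\<bar>Im (Ln (1 - z))\<bar> \<le> pi / 2"
      using Re_Ln_pos_le[of "1 - z"] False by simp
    moreover have "\<bar>Im (Ln b)\<bar> < pi / 2"
      using Re_Ln_pos_lt_imp[OF b] .
    ultimately have "Ln ((1 - z) * b) = Ln (1 - z) + Ln b"
      using False bnz by (intro Ln_times_simple) auto
    then show ?thesis
      unfolding base b_def[symmetric] using False bnz
      by (simp add: powr_def distrib_left exp_add)
  qed
qed

lemma continuous_on_genfun2:
  assumes \<alpha>: "1 < \<alpha>" "\<alpha> < 2"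
  shows "continuous_on (cball 0 1) (genfun2 \<alpha>)"
proof -
  define q where "q = (2 - \<alpha>) / (2 * \<alpha>)"
  have q: "0 < q" "q < 1 / 2"
    using \<alpha> by (auto simp: q_def field_simps)
  have "Re (1 - z) \<ge> 0" if "norm z \<le> 1" for z
    using abs_Re_le_cmod[of z] that by simp
  moreover have "0 < Re (of_real (1 - q) + of_real q * z)" if "norm z \<le> 1" for z
    by (rule Re_add_scaled_pos[OF q that])
  ultimately have "continuous_on (cball 0 1) (\<lambda>z::complex.
      (1 - z) powr of_real \<alpha> * (of_real (1 - q) + of_real q * z) powr of_real \<alpha>)"
    using \<alpha> by (intro continuous_intros) (auto simp: less_imp_le)
  then show ?thesis
    by (rule continuous_on_eq) (simp add: genfun2_eq_prod[OF \<alpha>] q_def)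
qed

lemma one_minus_cis: "1 - cis t = of_real (2 * sin (t / 2)) * cis ((t - pi) / 2)"
proof -
  have "cis ((t - pi) / 2) = - \<i> * cis (t / 2)"
    by (simp add: diff_divide_distrib complex_eq_iff cos_diff sin_diff)
  moreover have "cos t = 1 - 2 * (sin (t / 2) * sin (t / 2))"
    using cos_double_sin[of "t / 2"] by (simp add: power2_eq_square)
  moreover have "sin t = 2 * (sin (t / 2) * cos (t / 2))"
    using sin_double[of "t / 2"] by simp
  ultimately show ?thesis
    by (simp add: complex_eq_iff)
qed

text \<open>For \<open>t > 0\<close> the argument \<open>\<psi>\<close> of \<open>cis (- t) * genfun2 \<alpha> (cis t)\<close> lies in
  \<open>[- pi, - \<alpha> * pi / 2]\<close>, where the cosine is nonpositive: the power of \<open>1 - cis t\<close> contributes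
  \<open>\<alpha> * (t - pi) / 2\<close>, the power of the other factor between \<open>0\<close> and
  \<open>\<alpha> * q * t = (1 - \<alpha> / 2) * t\<close>, and \<open>cis (- t)\<close> contributes \<open>- t\<close>.\<close>

lemma genfun2_symbol_upper_half:
  assumes \<alpha>: "1 < \<alpha>" "\<alpha> < 2" and t: "0 \<le> t" "t \<le> pi"
  shows "Re (cis (- t) * genfun2 \<alpha> (cis t)) \<le> 0"
proof (cases "t = 0")
  case True
  then show ?thesis by (simp add: genfun2_eq_prod[OF \<alpha>])
next
  case False
  then have t0: "0 < t" using t by simp
  define q where "q = (2 - \<alpha>) / (2 * \<alpha>)"
  have q: "0 < q" "q < 1 / 2"
    using \<alpha> by (auto simp: q_def field_simps)
  define b where "b = of_real (1 - q) + of_real q * cis t"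
  define \<phi> where "\<phi> = Im (Ln b)"
  have \<phi>: "0 \<le> \<phi>" "\<phi> \<le> q * t"
    using Im_Ln_convex_comb_cis[OF q t] by (simp_all add: \<phi>_def b_def)
  have "0 < Re b" unfolding b_def by (rule Re_add_scaled_pos[OF q]) simp
  then have bnz: "b \<noteq> 0" by auto
  have s: "sin (t / 2) > 0"
    using t t0 by (intro sin_gt_zero) auto
  define m where "m = ln (2 * sin (t / 2))"
  have a: "Ln (1 - cis t) = Complex m ((t - pi) / 2)"
  proof (rule Ln_unique)
    show "exp (Complex m ((t - pi) / 2)) = 1 - cis t"
      using s by (simp add: one_minus_cis exp_eq_polar m_def exp_of_real)
  qed (use t t0 in auto)
  have nz: "1 - cis t \<noteq> 0"
    using s by (simp add: one_minus_cis)
  define \<psi> where "\<psi> = \<alpha> * ((t - pi) / 2) + \<alpha> * \<phi> - t"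
  have "cis (- t) * genfun2 \<alpha> (cis t)
      = cis (- t) * (exp (of_real \<alpha> * Complex m ((t - pi) / 2)) * exp (of_real \<alpha> * Ln b))"
    using nz bnz unfolding genfun2_eq_prod[OF \<alpha>, of "cis t", simplified]
    by (simp add: powr_def a b_def q_def)
  also have "\<dots> = of_real (exp (\<alpha> * m) * exp (\<alpha> * Re (Ln b))) * cis \<psi>"
  proof -
    have "cis \<psi> = cis (- t) * (cis (\<alpha> * ((t - pi) / 2)) * cis (\<alpha> * \<phi>))"
      by (simp add: \<psi>_def cis_mult algebra_simps)
    then show ?thesis
      unfolding exp_eq_polar \<phi>_def by (simp del: Re_Ln)
  qed
  finally have "Re (cis (- t) * genfun2 \<alpha> (cis t))
      = exp (\<alpha> * m) * exp (\<alpha> * Re (Ln b)) * cos \<psi>"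
    by simp
  moreover have "cos \<psi> \<le> 0"
  proof -
    have "\<alpha> * \<phi> \<le> \<alpha> * (q * t)"
      using \<phi> \<alpha> by (intro mult_left_mono) auto
    also have "\<dots> = (1 - \<alpha> / 2) * t"
      using \<alpha> by (simp add: q_def field_simps)
    finally have "\<psi> \<le> - (\<alpha> * pi / 2)"
      by (simp add: \<psi>_def algebra_simps diff_divide_distrib)
    then have up: "\<psi> \<le> - (pi / 2)"
      using \<alpha> mult_right_mono[of 1 \<alpha> pi] pi_ge_zero by linarith
    have "(1 - \<alpha> / 2) * t \<le> (1 - \<alpha> / 2) * pi"
      using \<alpha> t by (intro mult_left_mono) auto
    moreover have "0 \<le> \<alpha> * \<phi>"
      using \<phi> \<alpha> by simp
    ultimately have lo: "- pi \<le> \<psi>"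
      by (simp add: \<psi>_def algebra_simps diff_divide_distrib)
    have "cos (\<psi> + pi) \<ge> 0"
      using up lo by (intro cos_ge_zero) auto
    then show ?thesis by simp
  qed
  ultimately show ?thesis
    by (simp add: mult_nonneg_nonpos)
qed

lemma genfun2_cnj:
  assumes "1 < \<alpha>" "\<alpha> < 2" "norm z \<le> 1"
  shows "genfun2 \<alpha> (cnj z) = cnj (genfun2 \<alpha> z)"
proof -
  define q where "q = (2 - \<alpha>) / (2 * \<alpha>)"
  have q: "0 < q" "q < 1 / 2"
    using assms by (auto simp: q_def field_simps)
  have "Re (1 - z) \<ge> 0"
    using abs_Re_le_cmod[of z] assms by simp
  moreover have "0 < Re (of_real (1 - q) + of_real q * z)"
    by (rule Re_add_scaled_pos[OF q]) (use assms in auto)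
  ultimately show ?thesis
    using assms by (simp add: genfun2_eq_prod cnj_powr flip: q_def)
qed

lemma genfun2_symbol_nonpos:
  assumes \<alpha>: "1 < \<alpha>" "\<alpha> < 2"
  shows "Re (cis (- t) * genfun2 \<alpha> (cis t)) \<le> 0"
proof -
  define s where "s = Arg (cis t)"
  have s: "cis t = cis s" "- pi < s" "s \<le> pi"
    using cis_Arg[of "cis t"] Arg_bounded[of "cis t"] by (auto simp: s_def sgn_cis)
  have neg: "cis (- t) = cis (- s)"
    using arg_cong[OF s(1), of cnj] by (simp add: cis_cnj)
  show ?thesis
  proof (cases "0 \<le> s")
    case True
    then show ?thesis
      using genfun2_symbol_upper_half[OF \<alpha>, of s] s neg by simp
  next
    case False
    have "cis (- s) * genfun2 \<alpha> (cis s) = cnj (cis (- (- s)) * genfun2 \<alpha> (cis (- s)))"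
      using genfun2_cnj[OF \<alpha>, of "cis s"] by (simp add: cis_cnj)
    then show ?thesis
      using genfun2_symbol_upper_half[OF \<alpha>, of "- s"] s neg False by simp
  qed
qed

section \<open>Toeplitz forms with nonpositive symbol\<close>

lemma has_integral_cis_int:
  fixes m :: int
  shows "((\<lambda>t. cis (of_int m * t)) has_integral (if m = 0 then 2 * of_real pi else 0)) {0..2 * pi}"
proof (cases "m = 0")
  case True
  then show ?thesis
    using has_integral_const_real[of "1::complex" 0 "2 * pi"]
    by (simp add: scaleR_conv_of_real)
next
  case False
  let ?G = "\<lambda>t. cis (of_int m * t) / (\<i> * of_int m)"
  have "((\<lambda>t. cis (of_int m * t)) has_integral ?G (2 * pi) - ?G 0) {0..2 * pi}"
  proof (rule fundamental_theorem_of_calculus)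
    fix t
    show "(?G has_vector_derivative cis (of_int m * t)) (at t within {0..2 * pi})"
      using False unfolding has_vector_derivative_def
      by (auto intro!: derivative_eq_intros simp: scaleR_conv_of_real mult_ac fun_eq_iff)
  qed simp
  moreover have "cis (of_int m * (2 * pi)) = 1"
    using cis_multiple_2pi[of "of_int m"] by (simp add: mult_ac)
  ultimately show ?thesis using False by simp
qed

text \<open>Fourier coefficients of a power series on a circle of radius \<open>r < 1\<close>; those of negative index
  vanish.\<close>

lemma has_integral_power_series_coeff:
  fixes c :: "nat \<Rightarrow> complex" and F :: "complex \<Rightarrow> complex" and n :: int
  assumes F: "\<And>z. norm z < 1 \<Longrightarrow> (\<lambda>l. c l * z ^ l) sums F z"
    and r: "0 \<le> r" "r < 1"
  shows "((\<lambda>t. F (of_real r * cis t) * cis (- of_int n * t))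
    has_integral (if 0 \<le> n then 2 * of_real pi * c (nat n) * of_real r ^ nat n else 0)) {0..2 * pi}"
    (is "(?f has_integral ?J) _")
proof -
  define s where "s = (1 + r) / 2"
  have s: "0 < s" "r < s" "s < 1" using r by (auto simp: s_def)
  have "summable (\<lambda>l. c l * of_real s ^ l)"
    using F[of "of_real s"] s by (auto simp: sums_iff)
  then have "ereal s \<le> conv_radius c"
    using conv_radius_geI[of c "of_real s"] s by simp
  then have rad: "ereal r < conv_radius c"
    using s by (meson ereal_less_eq(3) less_ereal.simps(1) less_le_trans)
  have term_eq: "c l * (of_real r * cis t) ^ l * cis (- of_int n * t)
      = c l * of_real r ^ l * cis (of_int (int l - n) * t)" for l t
    by (simp add: power_mult_distrib Complex.DeMoivre cis_mult algebra_simps)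
  have "uniform_limit {0..2 * pi} (\<lambda>N t. \<Sum>l<N. c l * (of_real r * cis t) ^ l)
          (\<lambda>t. F (of_real r * cis t)) sequentially"
  proof -
    have "uniform_limit {0..2 * pi} (\<lambda>N t. \<Sum>l<N. c l * (of_real r * cis t - 0) ^ l)
          (\<lambda>t. \<Sum>l. c l * (of_real r * cis t - 0) ^ l) sequentially"
      by (rule uniform_limit_compose'[OF powser_uniform_limit[OF rad]])
         (use r in \<open>auto simp: norm_mult\<close>)
    moreover have "(\<Sum>l. c l * (of_real r * cis t) ^ l) = F (of_real r * cis t)" for t
      using F[of "of_real r * cis t"] r by (simp add: sums_iff norm_mult)
    ultimately show ?thesis by simp
  qed
  moreover have "uniform_limit {0..2 * pi} (\<lambda>(N::nat) t. cis (- of_int n * t))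
      (\<lambda>t. cis (- of_int n * t)) sequentially"
    by (rule uniform_limit_const)
  moreover have "bounded ((\<lambda>t. F (of_real r * cis t)) ` {0..2 * pi})"
  proof -
    have "F holomorphic_on ball 0 1"
      by (rule power_series_holomorphic[of 0 1 c]) (use F in auto)
    then have "continuous_on (ball 0 1) F"
      by (rule holomorphic_on_imp_continuous_on)
    then have "continuous_on {0..2 * pi} (\<lambda>t. F (of_real r * cis t))"
      by (rule continuous_on_compose2) (use r in \<open>auto intro!: continuous_intros simp: norm_mult\<close>)
    then show ?thesis
      by (intro compact_imp_bounded compact_continuous_image) auto
  qed
  moreover have "bounded ((\<lambda>t. cis (- of_int n * t)) ` {0..2 * pi})"
    by (rule boundedI[of _ 1]) auto
  ultimately have "uniform_limit {0..2 * pi}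
      (\<lambda>N t. (\<Sum>l<N. c l * (of_real r * cis t) ^ l) * cis (- of_int n * t)) ?f sequentially"
    by (intro uniform_lim_mult)
  then have ul: "uniform_limit {0..2 * pi}
      (\<lambda>N t. \<Sum>l<N. c l * of_real r ^ l * cis (of_int (int l - n) * t)) ?f sequentially"
    by (simp only: sum_distrib_right term_eq)
  obtain I J where I: "\<And>N. ((\<lambda>t. \<Sum>l<N. c l * of_real r ^ l * cis (of_int (int l - n) * t))
        has_integral I N) {0..2 * pi}"
    and J: "(?f has_integral J) {0..2 * pi}" and lim: "I \<longlonglongrightarrow> J"
    by (rule uniform_limit_integral[OF ul]) (auto intro!: continuous_intros)
  have "I N = ?J" if "N > nat n" for N
  proof -
    have "((\<lambda>t. \<Sum>l<N. c l * of_real r ^ l * cis (of_int (int l - n) * t)) has_integral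
        (\<Sum>l<N. c l * of_real r ^ l * (if int l - n = 0 then 2 * of_real pi else 0))) {0..2 * pi}"
      by (intro has_integral_sum has_integral_mult_right has_integral_cis_int) auto
    then have "I N = (\<Sum>l<N. c l * of_real r ^ l * (if int l - n = 0 then 2 * of_real pi else 0))"
      using I has_integral_unique by blast
    also have "\<dots> = (\<Sum>l<N. if l = nat n then ?J else 0)"
      by (intro sum.cong) auto
    also have "\<dots> = ?J" using that by simp
    finally show ?thesis .
  qed
  then have "I \<longlonglongrightarrow> ?J"
    by (intro tendsto_eventually) (auto intro: eventually_sequentiallyI[of "Suc (nat n)"])
  then have "J = ?J" using lim LIMSEQ_unique by blast
  then show ?thesis using J by simp
qed

text \<open>The quadratic form of the Toeplitz matrix with entries \<open>c (j + 1 - i)\<close> is nonpositive if its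
  symbol has nonpositive real part on the unit circle.  With \<open>P t = (\<Sum>i\<in>I. w i * cis (i * t))\<close>, the
  form is, up to the factor \<open>2 * pi\<close>, the integral of \<open>cis (- t) * F (cis t) * \<bar>P t\<bar>\<^sup>2\<close>.  The power
  series need not be known to converge on the circle itself, so the identity is proved on circles of
  radius \<open>r < 1\<close>, and \<open>r\<close> tends to \<open>1\<close> using only the continuity of \<open>F\<close> on the closed disc.  The
  sign condition is not required, and in general fails, for \<open>r < 1\<close>.\<close>

lemma toeplitz_form_nonpos:
  fixes c :: "nat \<Rightarrow> real" and F :: "complex \<Rightarrow> complex" and w :: "nat \<Rightarrow> real"
  assumes sums: "\<And>z. norm z < 1 \<Longrightarrow> (\<lambda>l. of_real (c l) * z ^ l) sums F z"
    and cont: "continuous_on (cball 0 1) F"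
    and symbol: "\<And>t. Re (cis (- t) * F (cis t)) \<le> 0"
    and fin: "finite I"
  shows "(\<Sum>j\<in>I. \<Sum>i\<in>I. if i \<le> j + 1 then c (j + 1 - i) * w i * w j else 0) \<le> 0"
proof -
  define P where "P t = (\<Sum>i\<in>I. of_real (w i) * cis (real i * t))" for t
  define S where "S r = (\<Sum>j\<in>I. \<Sum>i\<in>I. if i \<le> j + 1 then c (j + 1 - i) * w i * w j * r ^ (j + 1 - i) else 0)"
    for r :: real
  let ?g = "\<lambda>r t. cis (- t) * F (of_real r * cis t) * (P t * cnj (P t))"
  have int: "(?g r has_integral of_real (2 * pi * S r)) {0..2 * pi}" if r: "0 \<le> r" "r < 1" for r
  proof -
    have "((\<lambda>t. \<Sum>j\<in>I. \<Sum>i\<in>I. of_real (w i * w j) *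
            (F (of_real r * cis t) * cis (- of_int (int j + 1 - int i) * t))) has_integral
          (\<Sum>j\<in>I. \<Sum>i\<in>I. of_real (w i * w j) *
            (if 0 \<le> int j + 1 - int i
             then 2 * of_real pi * of_real (c (nat (int j + 1 - int i))) *
                    of_real r ^ nat (int j + 1 - int i) else 0))) {0..2 * pi}"
      by (intro has_integral_sum has_integral_mult_right has_integral_power_series_coeff sums r fin)
    also have "(\<lambda>t. \<Sum>j\<in>I. \<Sum>i\<in>I. of_real (w i * w j) *
            (F (of_real r * cis t) * cis (- of_int (int j + 1 - int i) * t))) = ?g r"
    proof
      fix t
      have "cis (- of_int (int j + 1 - int i) * t) = cis (- t) * (cis (real i * t) * cis (- (real j * t)))" for i j
        by (simp add: cis_mult algebra_simps)
      then show "(\<Sum>j\<in>I. \<Sum>i\<in>I. of_real (w i * w j) *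
            (F (of_real r * cis t) * cis (- of_int (int j + 1 - int i) * t))) = ?g r t"
        unfolding P_def cnj_sum complex_cnj_mult cis_cnj complex_cnj_complex_of_real
          sum_distrib_left sum_distrib_right
        by (intro sum.cong) (simp_all add: mult_ac)
    qed
    also have "(\<Sum>j\<in>I. \<Sum>i\<in>I. of_real (w i * w j) *
            (if 0 \<le> int j + 1 - int i
             then 2 * of_real pi * of_real (c (nat (int j + 1 - int i))) *
                    of_real r ^ nat (int j + 1 - int i) else 0)) = complex_of_real (2 * pi * S r)"
      unfolding S_def sum_distrib_left of_real_sum
    proof (intro sum.cong refl)
      fix i j
      have "nat (int j + 1 - int i) = j + 1 - i" by linarith
      moreover have "0 \<le> int j + 1 - int i \<longleftrightarrow> i \<le> j + 1" by linarith
      ultimately show "of_real (w i * w j) *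
            (if 0 \<le> int j + 1 - int i
             then 2 * of_real pi * of_real (c (nat (int j + 1 - int i))) *
                    of_real r ^ nat (int j + 1 - int i) else 0) =
        complex_of_real (2 * pi * (if i \<le> j + 1 then c (j + 1 - i) * w i * w j * r ^ (j + 1 - i) else 0))"
        by simp
    qed
    finally show ?thesis .
  qed
  have contS: "continuous_on {0..1} S"
  proof -
    have "continuous_on {0..1} (\<lambda>r. if i \<le> j + 1 then c (j + 1 - i) * w i * w j * r ^ (j + 1 - i) else 0)" for i j
      by (cases "i \<le> j + 1") (auto intro!: continuous_intros)
    then show ?thesis unfolding S_def by (intro continuous_on_sum)
  qed
  have "continuous_on ({0..1} \<times> cbox 0 (2 * pi)) (\<lambda>(r, t). ?g r t)"
  proof -
    have "continuous_on ({0..1} \<times> cbox 0 (2 * pi)) (\<lambda>x. F (of_real (fst x) * cis (snd x)))"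
      by (rule continuous_on_compose2[OF cont]) (auto intro!: continuous_intros simp: norm_mult)
    then show ?thesis
      unfolding P_def split_def by (auto intro!: continuous_intros)
  qed
  then have contI: "continuous_on {0..1} (\<lambda>r. integral (cbox 0 (2 * pi)) (?g r))"
    by (rule integral_continuous_on_param)
  have "integral (cbox 0 (2 * pi)) (?g 1) = of_real (2 * pi * S 1)"
  proof -
    have "((\<lambda>r. integral (cbox 0 (2 * pi)) (?g r)) \<longlongrightarrow>
        integral (cbox 0 (2 * pi)) (?g 1)) (at 1 within {0..1})"
      using contI unfolding continuous_on_def by (rule bspec) simp
    moreover have "(S \<longlongrightarrow> S 1) (at 1 within {0..1})"
      using contS unfolding continuous_on_def by (rule bspec) simp
    ultimately have "((\<lambda>r. integral (cbox 0 (2 * pi)) (?g r) - of_real (2 * pi * S r)) \<longlongrightarrow>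
        integral (cbox 0 (2 * pi)) (?g 1) - of_real (2 * pi * S 1)) (at 1 within {0..1})"
      by (intro tendsto_intros)
    moreover have "((\<lambda>r. integral (cbox 0 (2 * pi)) (?g r) - of_real (2 * pi * S r)) \<longlongrightarrow> 0)
        (at 1 within {0..1})"
    proof (rule tendsto_eventually)
      show "\<forall>\<^sub>F r in at 1 within {0..1}.
          integral (cbox 0 (2 * pi)) (?g r) - of_real (2 * pi * S r) = 0"
        unfolding eventually_at_filter
        by (intro always_eventually) (use int in \<open>auto simp: integral_unique\<close>)
    qed
    moreover have "at (1::real) within {0..1} \<noteq> bot"
      by (simp add: at_within_Icc_at_left)
    ultimately have "integral (cbox 0 (2 * pi)) (?g 1) - of_real (2 * pi * S 1) = 0"
      by (rule tendsto_unique[rotated])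
    then show ?thesis by simp
  qed
  moreover have "?g 1 integrable_on cbox 0 (2 * pi)"
  proof (rule integrable_continuous)
    have "continuous_on (cbox 0 (2 * pi)) (\<lambda>t. F (cis t))"
      by (rule continuous_on_compose2[OF cont]) (auto intro!: continuous_intros)
    then show "continuous_on (cbox 0 (2 * pi)) (?g 1)"
      unfolding P_def by (auto intro!: continuous_intros)
  qed
  ultimately have "(?g 1 has_integral of_real (2 * pi * S 1)) (cbox 0 (2 * pi))"
    by (simp only: has_integral_integral)
  then have int1: "((\<lambda>t. Re (?g 1 t)) has_integral Re (of_real (2 * pi * S 1))) (cbox 0 (2 * pi))"
    by (rule has_integral_linear[OF _ bounded_linear_Re, unfolded o_def])
  have "Re (?g 1 t) \<le> 0" for t
  proof -
    have "?g 1 t = cis (- t) * F (cis t) * of_real ((norm (P t))\<^sup>2)"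
      unfolding complex_norm_square by simp
    then have "Re (?g 1 t) = Re (cis (- t) * F (cis t)) * (norm (P t))\<^sup>2"
      by (simp only: times_complex.sel Re_complex_of_real Im_complex_of_real mult_zero_right diff_0_right)
    then show ?thesis using symbol[of t] by (simp add: mult_nonpos_nonneg)
  qed
  then have "Re (of_real (2 * pi * S 1)) \<le> 0"
    by (rule has_integral_le[OF int1 has_integral_0])
  then have "S 1 \<le> 0"
    using pi_gt_zero by (auto simp: mult_le_0_iff)
  then show ?thesis by (simp add: S_def cong: if_cong)
qed

section \<open>The averaging operator\<close>

lemma sum_mult_shift:
  fixes v w :: "nat \<Rightarrow> real"
  assumes "v 0 = 0" "w M = 0"
  shows "(\<Sum>j\<in>{1..<M}. v j * w (j + 1)) = (\<Sum>j\<in>{1..<M}. v (j - 1) * w j)"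
proof -
  have "(\<Sum>j\<in>{1..<M}. v j * w (j + 1)) = (\<Sum>j\<in>{0..<M}. v j * w (j + 1))"
    using assms by (intro sum.mono_neutral_left) (auto simp: not_le)
  also have "\<dots> = (\<Sum>j\<in>{Suc 0..<Suc M}. v (j - 1) * w j)"
    by (subst sum.shift_bounds_Suc_ivl) simp
  also have "\<dots> = (\<Sum>j\<in>{1..<M}. v (j - 1) * w j)"
    using assms by (intro sum.mono_neutral_right) (auto simp: not_less less_Suc_eq)
  finally show ?thesis .
qed

text \<open>The bilinear form \<open>(v, opL w)\<close> over the interior grid points, without the factor \<open>h\<close>.\<close>

definition opL_form :: "real \<Rightarrow> nat \<Rightarrow> (nat \<Rightarrow> real) \<Rightarrow> (nat \<Rightarrow> real) \<Rightarrow> real" where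
  "opL_form \<alpha> M v w = (\<Sum>j\<in>{1..<M}. v j * opL \<alpha> w j)"

lemma opL_form_eq:
  assumes "v 0 = 0" "v M = 0" "w 0 = 0" "w M = 0"
  shows "opL_form \<alpha> M v w = (1 - 2 * sigma2 \<alpha>) * (\<Sum>j\<in>{1..<M}. v j * w j)
    + sigma2 \<alpha> * ((\<Sum>j\<in>{1..<M}. v j * w (j + 1)) + (\<Sum>j\<in>{1..<M}. w j * v (j + 1)))"
proof -
  have "opL_form \<alpha> M v w = (1 - 2 * sigma2 \<alpha>) * (\<Sum>j\<in>{1..<M}. v j * w j)
    + sigma2 \<alpha> * ((\<Sum>j\<in>{1..<M}. v j * w (j + 1)) + (\<Sum>j\<in>{1..<M}. w (j - 1) * v j))"
    unfolding opL_form_def opL_def sum_distrib_left sum.distrib[symmetric]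
    by (intro sum.cong) (auto simp: algebra_simps)
  then show ?thesis
    using sum_mult_shift[of w v M] assms by simp
qed

lemma opL_form_commute:
  assumes "v 0 = 0" "v M = 0" "w 0 = 0" "w M = 0"
  shows "opL_form \<alpha> M v w = opL_form \<alpha> M w v"
  using assms by (simp add: opL_form_eq mult.commute add.commute)

text \<open>The constant is the minimum of the symbol \<open>1 - 4 * sigma2 \<alpha> * (sin (\<theta> / 2))\<^sup>2\<close> of \<open>opL\<close>.\<close>

lemma opL_form_coercive:
  assumes "0 \<le> sigma2 \<alpha>" "w 0 = 0" "w M = 0"
  shows "(1 - 4 * sigma2 \<alpha>) * (\<Sum>j\<in>{1..<M}. (w j)\<^sup>2) \<le> opL_form \<alpha> M w w"
proof -
  let ?S = "\<Sum>j\<in>{1..<M}. (w j)\<^sup>2"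
  have "(\<Sum>j\<in>{1..<M}. (w (j + 1))\<^sup>2) \<le> ?S"
  proof -
    have "(\<Sum>j\<in>{1..<M}. (w (j + 1))\<^sup>2) = (\<Sum>j\<in>{Suc 1..<Suc M}. (w j)\<^sup>2)"
      by (subst sum.shift_bounds_Suc_ivl) simp
    also have "\<dots> = (\<Sum>j\<in>{Suc 1..<M}. (w j)\<^sup>2)"
      using assms by (intro sum.mono_neutral_right) (auto simp: not_less less_Suc_eq)
    also have "\<dots> \<le> ?S"
      by (intro sum_mono2) auto
    finally show ?thesis .
  qed
  moreover have "- (2 * (\<Sum>j\<in>{1..<M}. w j * w (j + 1))) \<le> ?S + (\<Sum>j\<in>{1..<M}. (w (j + 1))\<^sup>2)"
    unfolding sum_distrib_left sum_negf[symmetric] sum.distrib[symmetric]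
  proof (intro sum_mono)
    fix j
    show "- (2 * (w j * w (j + 1))) \<le> (w j)\<^sup>2 + (w (j + 1))\<^sup>2"
      using zero_le_power2[of "w j + w (j + 1)"] by (simp add: power2_sum)
  qed
  ultimately have "- (2 * ?S) \<le> 2 * (\<Sum>j\<in>{1..<M}. w j * w (j + 1))"
    by linarith
  then have "sigma2 \<alpha> * - (2 * ?S) \<le> sigma2 \<alpha> * (2 * (\<Sum>j\<in>{1..<M}. w j * w (j + 1)))"
    using assms(1) by (rule mult_left_mono)
  moreover have "opL_form \<alpha> M w w = (1 - 2 * sigma2 \<alpha>) * ?S
      + sigma2 \<alpha> * (2 * (\<Sum>j\<in>{1..<M}. w j * w (j + 1)))"
    using opL_form_eq[of w M w \<alpha>] assms by (simp only: power2_eq_square mult_2)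
  moreover have "(1 - 4 * sigma2 \<alpha>) * ?S = (1 - 2 * sigma2 \<alpha>) * ?S + sigma2 \<alpha> * - (2 * ?S)"
    by (simp add: left_diff_distrib)
  ultimately show ?thesis by linarith
qed

lemma sigma2_bounds:
  assumes "1 < \<alpha>" "\<alpha> < 2"
  shows "0 < sigma2 \<alpha>" "sigma2 \<alpha> < 1 / 4"
proof -
  have "(\<alpha> - 1) * (2 - \<alpha>) > 0" using assms by simp
  then have "2 * \<alpha>\<^sup>2 - 6 * \<alpha> + 3 < 0"
    by (simp add: algebra_simps power2_eq_square)
  then show "0 < sigma2 \<alpha>"
    using assms by (simp add: sigma2_def divide_less_0_iff)
  \<comment> \<open>The second bound amounts to \<open>4 * \<alpha>\<^sup>2 - 9 * \<alpha> + 6 > 0\<close>, shown by completing the square.\<close>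
  have "(2 * \<alpha> - 9 / 4)\<^sup>2 \<ge> 0" by simp
  then have "4 * \<alpha>\<^sup>2 - 9 * \<alpha> + 6 > 0"
    by (simp add: power2_eq_square algebra_simps)
  then show "sigma2 \<alpha> < 1 / 4"
    using assms by (simp add: sigma2_def field_simps)
qed

section \<open>Negativity of the discrete Riesz derivative\<close>

text \<open>For grid functions that vanish at both ends, the two sums in \<open>delta_x\<close> are the actions of a
  Toeplitz matrix and of its transpose on the interior grid points.\<close>

lemma delta_x_eq:
  assumes "w 0 = 0" "w M = 0" and j: "j \<in> {1..<M}"
  shows "delta_x \<alpha> M h w j = - 1 / (2 * cos (pi * \<alpha> / 2) * h powr \<alpha>) *
    ((\<Sum>i\<in>{1..<M}. if i \<le> j + 1 then kappa2 \<alpha> (j + 1 - i) * w i else 0) +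
     (\<Sum>i\<in>{1..<M}. if j \<le> i + 1 then kappa2 \<alpha> (i + 1 - j) * w i else 0))"
proof -
  have "(\<Sum>l = 0..j + 1. kappa2 \<alpha> l * w (j + 1 - l)) = (\<Sum>i = 0..j + 1. kappa2 \<alpha> (j + 1 - i) * w i)"
    by (rule sum.reindex_bij_witness[of _ "\<lambda>i. j + 1 - i" "\<lambda>i. j + 1 - i"]) auto
  also have "\<dots> = (\<Sum>i\<in>{0..M}. if i \<le> j + 1 then kappa2 \<alpha> (j + 1 - i) * w i else 0)"
    using j by (intro sum.mono_neutral_cong_left) auto
  also have "\<dots> = (\<Sum>i\<in>{1..<M}. if i \<le> j + 1 then kappa2 \<alpha> (j + 1 - i) * w i else 0)"
  proof (rule sum.mono_neutral_right)
    show "\<forall>i\<in>{0..M} - {1..<M}. (if i \<le> j + 1 then kappa2 \<alpha> (j + 1 - i) * w i else 0) = 0"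
    proof
      fix i assume "i \<in> {0..M} - {1..<M}"
      then have "i = 0 \<or> i = M" by auto
      then show "(if i \<le> j + 1 then kappa2 \<alpha> (j + 1 - i) * w i else 0) = 0"
        using assms by auto
    qed
  qed auto
  finally have 1: "(\<Sum>l = 0..j + 1. kappa2 \<alpha> l * w (j + 1 - l)) = \<dots>" .
  have "(\<Sum>l = 0..M - j + 1. kappa2 \<alpha> l * w (j + l - 1)) = (\<Sum>i = j - 1..M. kappa2 \<alpha> (i + 1 - j) * w i)"
    by (rule sum.reindex_bij_witness[of _ "\<lambda>i. i + 1 - j" "\<lambda>l. j + l - 1"]) (use j in auto)
  also have "\<dots> = (\<Sum>i\<in>{0..M}. if j \<le> i + 1 then kappa2 \<alpha> (i + 1 - j) * w i else 0)"
    using j by (intro sum.mono_neutral_cong_left) auto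
  also have "\<dots> = (\<Sum>i\<in>{1..<M}. if j \<le> i + 1 then kappa2 \<alpha> (i + 1 - j) * w i else 0)"
  proof (rule sum.mono_neutral_right)
    show "\<forall>i\<in>{0..M} - {1..<M}. (if j \<le> i + 1 then kappa2 \<alpha> (i + 1 - j) * w i else 0) = 0"
    proof
      fix i assume "i \<in> {0..M} - {1..<M}"
      then have "i = 0 \<or> i = M" by auto
      then show "(if j \<le> i + 1 then kappa2 \<alpha> (i + 1 - j) * w i else 0) = 0"
        using assms by auto
    qed
  qed auto
  finally show ?thesis
    unfolding delta_x_def 1 by simp
qed

lemma delta_x_form_nonpos:
  assumes \<alpha>: "1 < \<alpha>" "\<alpha> < 2" and w: "w 0 = 0" "w M = 0"
  shows "(\<Sum>j\<in>{1..<M}. w j * delta_x \<alpha> M h w j) \<le> 0"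
proof -
  define I where "I = {1..<M}"
  define S where "S = (\<Sum>j\<in>I. \<Sum>i\<in>I. if i \<le> j + 1 then kappa2 \<alpha> (j + 1 - i) * w i * w j else 0)"
  define g where "g = - 1 / (2 * cos (pi * \<alpha> / 2) * h powr \<alpha>)"
  have S: "S \<le> 0"
    unfolding S_def
    by (rule toeplitz_form_nonpos[where F = "genfun2 \<alpha>"])
       (use kappa2_sums[OF \<alpha>] continuous_on_genfun2[OF \<alpha>] genfun2_symbol_nonpos[OF \<alpha>]
         in \<open>auto simp: I_def\<close>)
  have "cos (pi * \<alpha> / 2 - pi) \<ge> 0"
  proof (intro cos_ge_zero)
    have "pi * 1 \<le> pi * \<alpha>" "pi * \<alpha> \<le> pi * 2"
      using \<alpha> by (intro mult_left_mono; simp)+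
    then show "- (pi / 2) \<le> pi * \<alpha> / 2 - pi" "pi * \<alpha> / 2 - pi \<le> pi / 2"
      by linarith+
  qed
  then have "cos (pi * \<alpha> / 2) \<le> 0" by simp
  then have g: "0 \<le> g"
    by (simp add: g_def divide_nonneg_nonpos mult_nonpos_nonneg divide_nonpos_nonpos)
  have "(\<Sum>j\<in>I. w j * delta_x \<alpha> M h w j) = (\<Sum>j\<in>I. g *
      ((\<Sum>i\<in>I. if i \<le> j + 1 then kappa2 \<alpha> (j + 1 - i) * w i * w j else 0) +
       (\<Sum>i\<in>I. if j \<le> i + 1 then kappa2 \<alpha> (i + 1 - j) * w j * w i else 0)))"
  proof (rule sum.cong)
    fix j assume j: "j \<in> I"
    show "w j * delta_x \<alpha> M h w j = g *
      ((\<Sum>i\<in>I. if i \<le> j + 1 then kappa2 \<alpha> (j + 1 - i) * w i * w j else 0) +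
       (\<Sum>i\<in>I. if j \<le> i + 1 then kappa2 \<alpha> (i + 1 - j) * w j * w i else 0))"
      unfolding delta_x_eq[OF w j[unfolded I_def]] g_def[symmetric] I_def[symmetric]
        mult.left_commute[of "w j"] distrib_left[of "w j"] sum_distrib_left[of "w j"]
      by (intro arg_cong2[of _ _ _ _ "(*)"] arg_cong2[of _ _ _ _ "(+)"] sum.cong refl)
         (auto simp: mult_ac)
  qed simp
  also have "\<dots> = g * (S + (\<Sum>j\<in>I. \<Sum>i\<in>I. if j \<le> i + 1 then kappa2 \<alpha> (i + 1 - j) * w j * w i else 0))"
    by (simp only: sum_distrib_left[symmetric] sum.distrib S_def)
  also have "(\<Sum>j\<in>I. \<Sum>i\<in>I. if j \<le> i + 1 then kappa2 \<alpha> (i + 1 - j) * w j * w i else 0) = S"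
    unfolding S_def by (rule sum.swap)
  also have "g * (S + S) \<le> 0"
    using g S by (intro mult_nonneg_nonpos) auto
  finally show ?thesis by (simp add: I_def)
qed

section \<open>The energy estimate\<close>

text \<open>Testing the residual with the time average \<open>a\<close>: the difference quotient gives the increment of
  the energy \<open>opL_form \<alpha> M (e k) (e k)\<close>, the diffusion term is dissipative, and the reaction term
  \<open>opL_form \<alpha> M a a \<ge> c * \<parallel>a\<parallel>\<^sup>2\<close> absorbs the residual.\<close>

lemma energy_step:
  fixes e :: "nat \<Rightarrow> nat \<Rightarrow> real"
  assumes \<alpha>: "1 < \<alpha>" "\<alpha> < 2" and "0 \<le> K" and \<tau>: "0 < \<tau>"
    and bc: "e k 0 = 0" "e k M = 0" "e (k + 1) 0 = 0" "e (k + 1) M = 0"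
    and res: "\<And>j. j \<in> {1..<M} \<Longrightarrow>
      \<bar>opL \<alpha> (delta_t \<tau> e k) j + opL \<alpha> (time_avg e k) j - K * delta_x \<alpha> M h (time_avg e k) j\<bar> \<le> D"
  shows "opL_form \<alpha> M (e (k + 1)) (e (k + 1))
    \<le> opL_form \<alpha> M (e k) (e k) + \<tau> * (real M * D\<^sup>2) / (2 * (1 - 4 * sigma2 \<alpha>))"
proof -
  define c where "c = 1 - 4 * sigma2 \<alpha>"
  have c: "c > 0" using sigma2_bounds[OF \<alpha>] by (simp add: c_def)
  define I where "I = {1..<M}"
  define a where "a = time_avg e k"
  define \<rho> where "\<rho> j = opL \<alpha> (delta_t \<tau> e k) j + opL \<alpha> a j - K * delta_x \<alpha> M h a j" for j
  have a0: "a 0 = 0" "a M = 0" using bc by (simp_all add: a_def time_avg_def)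
  let ?B = "opL_form \<alpha> M"
  have "(\<Sum>j\<in>I. a j * opL \<alpha> (delta_t \<tau> e k) j) =
      (?B (e (k + 1)) (e (k + 1)) - ?B (e k) (e k)) / (2 * \<tau>)"
  proof -
    have "(\<Sum>j\<in>I. a j * opL \<alpha> (delta_t \<tau> e k) j) =
       (?B (e (k + 1)) (e (k + 1)) - ?B (e (k + 1)) (e k) + ?B (e k) (e (k + 1)) - ?B (e k) (e k)) / (2 * \<tau>)"
      unfolding opL_form_def I_def a_def time_avg_def delta_t_def opL_def sum_subtractf[symmetric]
        sum.distrib[symmetric] sum_divide_distrib
      by (intro sum.cong) (use \<tau> in \<open>auto simp: field_simps\<close>)
    also have "?B (e (k + 1)) (e k) = ?B (e k) (e (k + 1))"
      by (rule opL_form_commute) (use bc in auto)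
    finally show ?thesis by simp
  qed
  then have "(\<Sum>j\<in>I. a j * \<rho> j) = (?B (e (k + 1)) (e (k + 1)) - ?B (e k) (e k)) / (2 * \<tau>)
      + ?B a a - K * (\<Sum>j\<in>I. a j * delta_x \<alpha> M h a j)"
    unfolding \<rho>_def opL_form_def I_def
    by (simp add: sum.distrib sum_subtractf sum_distrib_left algebra_simps)
  moreover have "K * (\<Sum>j\<in>I. a j * delta_x \<alpha> M h a j) \<le> 0"
    using delta_x_form_nonpos[of \<alpha> a M h] \<alpha> a0 \<open>0 \<le> K\<close> by (simp add: I_def mult_nonneg_nonpos)
  moreover have "c * (\<Sum>j\<in>I. (a j)\<^sup>2) \<le> ?B a a"
    unfolding c_def I_def by (rule opL_form_coercive) (use sigma2_bounds[OF \<alpha>] a0 in auto)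
  moreover have "(\<Sum>j\<in>I. a j * \<rho> j) \<le> c * (\<Sum>j\<in>I. (a j)\<^sup>2) + real M * D\<^sup>2 / (4 * c)"
  proof -
    have "a j * \<rho> j \<le> c * (a j)\<^sup>2 + D\<^sup>2 / (4 * c)" if "j \<in> I" for j
    proof -
      \<comment> \<open>Young's inequality, weighted so that its first term is the lower bound of the reaction term.\<close>
      have "0 \<le> (2 * c * a j - \<rho> j)\<^sup>2" by simp
      then have "4 * c * (a j * \<rho> j) \<le> 4 * c * (c * (a j)\<^sup>2) + (\<rho> j)\<^sup>2"
        by (simp add: power2_eq_square algebra_simps)
      also have "(\<rho> j)\<^sup>2 \<le> D\<^sup>2"
        using power_mono[OF res[OF that[unfolded I_def]], of 2] by (simp add: \<rho>_def a_def)
      finally show ?thesis using c by (simp add: field_simps)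
    qed
    then have "(\<Sum>j\<in>I. a j * \<rho> j) \<le> (\<Sum>j\<in>I. c * (a j)\<^sup>2 + D\<^sup>2 / (4 * c))"
      by (rule sum_mono)
    also have "\<dots> = c * (\<Sum>j\<in>I. (a j)\<^sup>2) + real (card I) * (D\<^sup>2 / (4 * c))"
      by (simp add: sum.distrib sum_distrib_left)
    also have "real (card I) * (D\<^sup>2 / (4 * c)) \<le> real M * (D\<^sup>2 / (4 * c))"
      using c by (intro mult_right_mono) (auto simp: I_def)
    finally show ?thesis by simp
  qed
  ultimately have "(?B (e (k + 1)) (e (k + 1)) - ?B (e k) (e k)) / (2 * \<tau>) \<le> real M * D\<^sup>2 / (4 * c)"
    by linarith
  then show ?thesis
    using \<tau> c unfolding c_def[symmetric] by (simp add: field_simps)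
qed

lemma energy_bound:
  fixes e :: "nat \<Rightarrow> nat \<Rightarrow> real"
  assumes \<alpha>: "1 < \<alpha>" "\<alpha> < 2" and "0 \<le> K" and \<tau>: "0 < \<tau>"
    and init: "\<And>j. j \<le> M \<Longrightarrow> e 0 j = 0"
    and bc: "\<And>k. k \<le> N \<Longrightarrow> e k 0 = 0" "\<And>k. k \<le> N \<Longrightarrow> e k M = 0"
    and res: "\<And>k j. k < N \<Longrightarrow> j \<in> {1..<M} \<Longrightarrow>
      \<bar>opL \<alpha> (delta_t \<tau> e k) j + opL \<alpha> (time_avg e k) j - K * delta_x \<alpha> M h (time_avg e k) j\<bar> \<le> D"
    and k: "k \<le> N"
  shows "opL_form \<alpha> M (e k) (e k) \<le> real k * (\<tau> * (real M * D\<^sup>2) / (2 * (1 - 4 * sigma2 \<alpha>)))"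
  using k
proof (induction k)
  case 0
  have "opL_form \<alpha> M (e 0) (e 0) = 0"
    unfolding opL_form_def by (intro sum.neutral) (use init in auto)
  then show ?case by simp
next
  case (Suc k)
  let ?X = "\<tau> * (real M * D\<^sup>2) / (2 * (1 - 4 * sigma2 \<alpha>))"
  have "opL_form \<alpha> M (e (k + 1)) (e (k + 1)) \<le> opL_form \<alpha> M (e k) (e k) + ?X"
    by (rule energy_step[OF \<alpha> \<open>0 \<le> K\<close> \<tau>, where h = h]) (use Suc.prems bc res in auto)
  also have "\<dots> \<le> real k * ?X + ?X"
    using Suc by (intro add_right_mono) auto
  also have "\<dots> = real (Suc k) * ?X"
    by (simp only: of_nat_Suc distrib_right mult_1_left add.commute)
  finally show ?case by simp
qed

theorem theorem4p6:
  fixes \<alpha> K L T :: real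
    and f u :: "real \<Rightarrow> real \<Rightarrow> real"
    and u0 :: "real \<Rightarrow> real"
  assumes "1 < \<alpha>" and "\<alpha> < 2" and "0 < K" and "0 < L" and "0 < T"
    and "pde_solution \<alpha> K L T f u0 u"
    and "\<exists>C>0. \<forall>M>0. \<forall>N>0. \<forall>k<N. \<forall>j\<in>{1..<M}.
           \<bar>truncation_error \<alpha> K L T f u M N k j\<bar>
             \<le> C * ((T / real N)\<^sup>2 + (L / real M) ^ 3)"
  shows "\<exists>C1::real. \<forall>M>0. \<forall>N>0. \<forall>v.
           scheme_solution \<alpha> K L T f u0 M N v \<longrightarrow>
           (\<forall>k\<le>N.
              grid_norm M (L / real M)
                (\<lambda>j. v k j - u (real j * (L / real M)) (real k * (T / real N)))
              \<le> sqrt (6 * L * T) / 6 * C1 * exp (1 / 3 * T)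
                  * ((T / real N)\<^sup>2 + (L / real M) ^ 3))"
proof -
  note \<alpha> = assms(1,2)
  obtain C where C: "C > 0" and *: "\<forall>M>0. \<forall>N>0. \<forall>k<N. \<forall>j\<in>{1..<M}.
      \<bar>truncation_error \<alpha> K L T f u M N k j\<bar> \<le> C * ((T / real N)\<^sup>2 + (L / real M) ^ 3)"
    using assms(7) by (elim exE conjE)
  have trunc: "\<bar>truncation_error \<alpha> K L T f u M N k j\<bar> \<le> C * ((T / real N)\<^sup>2 + (L / real M) ^ 3)"
    if "M > 0" "N > 0" "k < N" "j \<in> {1..<M}" for M N k j
    by (rule *[rule_format, OF that])
  define c where "c = 1 - 4 * sigma2 \<alpha>"
  have c: "c > 0" using sigma2_bounds[OF \<alpha>] by (simp add: c_def)
  \<comment> \<open>The energy estimate gives \<open>sqrt (L * T / 2) * C / c\<close>, and \<open>sqrt (L * T / 2)\<close> is at most twice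
     \<open>sqrt (6 * L * T) / 6 = sqrt (L * T / 6)\<close>.\<close>
  show ?thesis
  proof (intro exI[of _ "2 * C / c"] allI impI)
    fix M N k :: nat and v
    assume M: "M > 0" and N: "N > 0" and sol: "scheme_solution \<alpha> K L T f u0 M N v" and k: "k \<le> N"
    define h \<tau> E where "h = L / real M" and "\<tau> = T / real N" and "E = \<tau>\<^sup>2 + h ^ 3"
    have pos: "h > 0" "\<tau> > 0" and MN: "real M * h = L" "real N * \<tau> = T"
      using M N assms by (auto simp: h_def \<tau>_def)
    have E: "E \<ge> 0" using pos by (simp add: E_def)
    define e where "e k j = v k j - on_grid h \<tau> u k j" for k j
    have scheme: "opL \<alpha> (delta_t \<tau> v k) j = - opL \<alpha> (time_avg v k) j
        + K * delta_x \<alpha> M h (time_avg v k) j + opL \<alpha> (half_step h \<tau> f k) j"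
      if "k < N" "j \<in> {1..<M}" for k j
      using sol that unfolding scheme_solution_def Let_def h_def \<tau>_def by blast
    have init_v: "v 0 j = u0 (real j * h)" if "j \<le> M" for j
      using sol that unfolding scheme_solution_def Let_def h_def by blast
    have bc_v: "v k 0 = 0" "v k M = 0" if "k \<in> {1..N}" for k
      using sol that unfolding scheme_solution_def Let_def by blast+
    have init_u: "u x 0 = u0 x" if "0 \<le> x" "x \<le> L" for x
      using assms(6) that unfolding pde_solution_def by blast
    have bc_u: "u 0 t = 0" "u L t = 0" if "0 < t" "t \<le> T" for t
      using assms(6) that unfolding pde_solution_def by blast+
    \<comment> \<open>The initial condition holds on the closed interval, so \<open>e 0\<close> vanishes at the end points even
       where \<open>u0\<close> does not.\<close>
    have init: "e 0 j = 0" if "j \<le> M" for j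
    proof -
      have "real j * h \<le> real M * h" using that pos by (intro mult_right_mono) auto
      then show ?thesis
        using init_v[OF that] init_u[of "real j * h"] pos by (simp add: e_def on_grid_def MN)
    qed
    have bc: "e k 0 = 0" "e k M = 0" if "k \<le> N" for k
    proof -
      have "e k 0 = 0 \<and> e k M = 0"
      proof (cases "k = 0")
        case True
        then show ?thesis using init by simp
      next
        case False
        have "real k * \<tau> \<le> real N * \<tau>" using that pos by (intro mult_right_mono) auto
        then show ?thesis
          using False that bc_v[of k] bc_u[of "real k * \<tau>"] pos
          by (simp add: e_def on_grid_def MN)
      qed
      then show "e k 0 = 0" "e k M = 0" by auto
    qed
    have res: "\<bar>opL \<alpha> (delta_t \<tau> e k) j + opL \<alpha> (time_avg e k) j
        - K * delta_x \<alpha> M h (time_avg e k) j\<bar> \<le> C * E" if kj: "k < N" "j \<in> {1..<M}" for k j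
    proof -
      let ?U = "on_grid h \<tau> u"
      have t: "opL \<alpha> (delta_t \<tau> e k) j = opL \<alpha> (delta_t \<tau> v k) j - opL \<alpha> (delta_t \<tau> ?U k) j"
        by (simp add: opL_def delta_t_def e_def diff_divide_distrib add_divide_distrib algebra_simps)
      have a: "opL \<alpha> (time_avg e k) j = opL \<alpha> (time_avg v k) j - opL \<alpha> (time_avg ?U k) j"
        by (simp add: opL_def time_avg_def e_def diff_divide_distrib add_divide_distrib algebra_simps)
      have te: "time_avg e k i = time_avg v k i - time_avg ?U k i" for i
        by (simp add: time_avg_def e_def diff_divide_distrib add_divide_distrib)
      have x: "delta_x \<alpha> M h (time_avg e k) j
          = delta_x \<alpha> M h (time_avg v k) j - delta_x \<alpha> M h (time_avg ?U k) j"
        unfolding delta_x_def te right_diff_distrib sum_subtractf by (simp add: algebra_simps)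
      have "opL \<alpha> (delta_t \<tau> e k) j + opL \<alpha> (time_avg e k) j - K * delta_x \<alpha> M h (time_avg e k) j
          = - truncation_error \<alpha> K L T f u M N k j"
        unfolding t a x scheme[OF kj] truncation_error_def Let_def h_def[symmetric] \<tau>_def[symmetric]
        by (simp add: algebra_simps)
      then show ?thesis
        using trunc[OF M N kj] by (simp add: E_def h_def \<tau>_def)
    qed
    have "c * (h * (\<Sum>j\<in>{1..<M}. (e k j)\<^sup>2)) = h * (c * (\<Sum>j\<in>{1..<M}. (e k j)\<^sup>2))"
      by simp
    also have "\<dots> \<le> h * opL_form \<alpha> M (e k) (e k)"
      unfolding c_def using pos sigma2_bounds[OF \<alpha>] bc[OF k]
      by (intro mult_left_mono opL_form_coercive) auto
    also have "\<dots> \<le> h * (real k * (\<tau> * (real M * (C * E)\<^sup>2) / (2 * c)))"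
      unfolding c_def using pos assms(3)
      by (intro mult_left_mono energy_bound[OF \<alpha> _ pos(2) init bc res k]) auto
    also have "\<dots> \<le> h * (real N * (\<tau> * (real M * (C * E)\<^sup>2) / (2 * c)))"
      using pos k c by (intro mult_left_mono mult_right_mono) auto
    also have "\<dots> = (real M * h) * (real N * \<tau>) * (C * E)\<^sup>2 / (2 * c)"
      by simp
    also have "\<dots> = c * (L * T / 2 * (C * E / c)\<^sup>2)"
      unfolding MN using c by (simp add: field_simps power2_eq_square)
    finally have "h * (\<Sum>j\<in>{1..<M}. (e k j)\<^sup>2) \<le> L * T / 2 * (C * E / c)\<^sup>2"
      using c by simp
    also have "\<dots> \<le> L * T / 6 * (2 * C / c * E)\<^sup>2"
    proof -
      have "(2 * C / c * E)\<^sup>2 = 4 * (C * E / c)\<^sup>2"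
        by (simp add: power_mult_distrib power_divide)
      moreover have "0 \<le> L * T * (C * E / c)\<^sup>2"
        using assms by simp
      ultimately show ?thesis by simp
    qed
    also have "\<dots> = (sqrt (6 * L * T) / 6 * (2 * C / c * E))\<^sup>2"
      using assms by (simp add: power_mult_distrib[of "sqrt (6 * L * T) / 6"] power_divide[of "sqrt (6 * L * T)"]
        del: real_sqrt_mult times_divide_eq_left times_divide_eq_right)
    finally have "grid_norm M h (e k) \<le> sqrt (6 * L * T) / 6 * (2 * C / c * E)"
      unfolding grid_norm_def using c C E assms by (intro real_le_lsqrt) auto
    also have "\<dots> \<le> sqrt (6 * L * T) / 6 * (2 * C / c * E) * exp (1 / 3 * T)"
      using c C E assms
        mult_left_mono[of 1 "exp (1 / 3 * T)" "sqrt (6 * L * T) / 6 * (2 * C / c * E)"] by simp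
    finally have "grid_norm M h (e k) \<le> sqrt (6 * L * T) / 6 * (2 * C / c) * exp (1 / 3 * T) * E"
      by (simp only: mult_ac)
    then show "grid_norm M (L / real M)
          (\<lambda>j. v k j - u (real j * (L / real M)) (real k * (T / real N)))
        \<le> sqrt (6 * L * T) / 6 * (2 * C / c) * exp (1 / 3 * T) * ((T / real N)\<^sup>2 + (L / real M) ^ 3)"
      by (simp only: e_def[abs_def] on_grid_def E_def h_def \<tau>_def)
  qed
qed

end
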